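(* Let $S$ be a left reductive regular semigroup. The normal category $\mathbb L(S)$ is connected by the regular poset $\mathfrak R=\{R_{r^e}: e\in E(S)\}$, that is, $\mathbb L(S)_{\mathfrak R}$ is a connected category.
   Context: Conventions. Mappings and morphisms are composed from left to right ($fg$ means first $f$, then $g$). For a category $\mathcal C$, $v\mathcal C$ denotes its class of objects and $\mathcal C(c,c')$ the set of morphisms from $c$ to $c'$. A monomorphism is a right cancellable morphism and an epimorphism is a left cancellable morphism. Semigroups. A semigroup $S$ is regular if for every $a\in S$ there is $x\in S$ with $axa=a$; $E(S)$ is its set of idempotents. It is left reductive if the map $a\mapsto\rho_a$, where $\rho_a\colon S\to S$, $x\mapsto xa$, is injective. $L_a$ denotes the $\mathscr L$-class of $a$. A regular poset is a poset order isomorphic to the poset of $\mathscr R$-classes of a regular semigroup (ordered by inclusion of the corresponding principal right ideals). Normal categories. A strict preorder is a category with at most one morphism between any two (possibly equal) objects in which the only isomorphisms are identities. A category with subobjects is a small category $\mathcal C$ with a subcategory $\mathcal P$ such that: $\mathcal P$ is a strict preorder with $v\mathcal P=v\mathcal C$; every $f\in\mathcal P$ is a monomorphism in $\mathcal C$; if $f,g\in\mathcal P$ and $f=hg$ with $h\in\mathcal C$, then $h\in\mathcal P$. Morphisms of $\mathcal P$ are called inclusions; $c\preceq c'$ means $\mathcal P(c,c')\neq\emptyset$, and $j(c,c')$ is then the unique inclusion. An inclusion $j\colon c\to c'$ splits if there is $q\colon c'\to c$ in $\mathcal C$ with $jq=1_c$; such a $q$ is called a retraction. A normal factorisation of a morphism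 $f$ is $f=quj$ with $q$ a retraction, $u$ an isomorphism, $j$ an inclusion. A cone with vertex $z\in v\mathcal C$ is a map $\gamma$ assigning to each $c\in v\mathcal C$ a morphism $\gamma(c)\in\mathcal C(c,z)$ such that $j(a,b)\gamma(b)=\gamma(a)$ whenever $a\preceq b$, and $\gamma(c)$ is an isomorphism for at least one $c$; the vertex is denoted $z_\gamma$. $\mathcal C$ is a normal category if it is a category with subobjects in which every inclusion splits, every morphism has a normal factorisation, and for each $c\in v\mathcal C$ there is a cone $\mu$ with vertex $c$ and $\mu(c)=1_c$. In a normal category, for a normal factorisation $f=quj$ the epimorphism $f^\circ:=qu$ does not depend on the factorisation. Semigroup of cones. For a cone $\gamma$ and an epimorphism $f$ with domain $z_\gamma$, $\gamma\ast f$ is the cone $c\mapsto\gamma(c)f$. The set $\widehat{\mathcal C}$ of all cones in a normal category $\mathcal C$ is a regular semigroup under $\gamma\cdot\delta=\gamma\ast(\delta(z_\gamma))^\circ$. Let $\mathscr R$ be Green's relation on $\widehat{\mathcal C}$, $R_\gamma$ the $\mathscr R$-class of $\gamma$; $\widehat{\mathcal C}/\mathscr R$ is partially ordered by $R_\gamma\sqsubseteq R_\delta$ iff the principal right ideal generated by $\gamma$ is contained in that generated by $\delta$. Connected categories. A normal category $\mathcal C$ is connected by a down-set $\mathfrak D$ of $(\widehat{\mathcal C}/\mathscr R,\sqsubseteq)$ if for every $c\in v\mathcal C$ some $\mathfrak d\in\mathfrak D$ contains an idempotent cone with vertex $c$; then the pair is denoted $\mathcal C_{\mathfrak D}$ and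 called a connected category. The category $\mathbb L(S)$. For a regular semigroup $S$, $\mathbb L(S)$ is the category whose objects are the principal left ideals $Se$ ($e\in E(S)$) and whose morphisms from $Se$ to $Sf$ are the mappings $r(e,u,f)\colon Se\to Sf$, $x\mapsto xu$, for $u\in eSf$, composed as maps; its inclusions are the morphisms $r(e,e,f)$ for $Se\subseteq Sf$. It is a normal category. For $a\in S$, $r^a$ is the (principal) cone in $\mathbb L(S)$ with $r^a(Se)=r(e,ea,f)$ for every $Se$, where $f\in E(L_a)$; its vertex is $Sf=Sa$. In $\mathfrak R$, $R_{r^e}$ is the $\mathscr R$-class of $r^e$ in the semigroup $\widehat{\mathbb L(S)}$, and $\mathfrak R\subseteq\widehat{\mathbb L(S)}/\mathscr R$ carries the induced order. *)

theory Defs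
  imports "HOL-Library.FuncSet"
begin

section \<open>Semigroups\<close>

text \<open>Semigroups are given by a carrier set and an operation whose values outside the
  carrier are irrelevant, because the semigroup of cones lives on a proper subset of its type.\<close>

definition semigroup_on :: "'a set \<Rightarrow> ('a \<Rightarrow> 'a \<Rightarrow> 'a) \<Rightarrow> bool" where
  "semigroup_on S m \<longleftrightarrow>
    (\<forall>a\<in>S. \<forall>b\<in>S. m a b \<in> S) \<and>
    (\<forall>a\<in>S. \<forall>b\<in>S. \<forall>c\<in>S. m (m a b) c = m a (m b c))"

definition regular_semigroup :: "'a set \<Rightarrow> ('a \<Rightarrow> 'a \<Rightarrow> 'a) \<Rightarrow> bool" where
  "regular_semigroup S m \<longleftrightarrow> semigroup_on S m \<and> (\<forall>a\<in>S. \<exists>x\<in>S. m (m a x) a = a)"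

definition left_reductive :: "'a set \<Rightarrow> ('a \<Rightarrow> 'a \<Rightarrow> 'a) \<Rightarrow> bool" where
  "left_reductive S m \<longleftrightarrow> inj_on (\<lambda>a. \<lambda>x\<in>S. m x a) S"

definition idempotents :: "'a set \<Rightarrow> ('a \<Rightarrow> 'a \<Rightarrow> 'a) \<Rightarrow> 'a set" where
  "idempotents S m = {e\<in>S. m e e = e}"

text \<open>The principal one-sided ideals $aS^1$ and $S^1a$; for regular \<open>a\<close> these are
  $aS$ and $Sa$.\<close>

definition right_ideal :: "'a set \<Rightarrow> ('a \<Rightarrow> 'a \<Rightarrow> 'a) \<Rightarrow> 'a \<Rightarrow> 'a set" where
  "right_ideal S m a = insert a ((\<lambda>x. m a x) ` S)"

definition left_ideal :: "'a set \<Rightarrow> ('a \<Rightarrow> 'a \<Rightarrow> 'a) \<Rightarrow> 'a \<Rightarrow> 'a set" where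
  "left_ideal S m a = insert a ((\<lambda>x. m x a) ` S)"

definition R_class :: "'a set \<Rightarrow> ('a \<Rightarrow> 'a \<Rightarrow> 'a) \<Rightarrow> 'a \<Rightarrow> 'a set" where
  "R_class S m a = {b\<in>S. right_ideal S m b = right_ideal S m a}"

definition L_class :: "'a set \<Rightarrow> ('a \<Rightarrow> 'a \<Rightarrow> 'a) \<Rightarrow> 'a \<Rightarrow> 'a set" where
  "L_class S m a = {b\<in>S. left_ideal S m b = left_ideal S m a}"

definition R_classes :: "'a set \<Rightarrow> ('a \<Rightarrow> 'a \<Rightarrow> 'a) \<Rightarrow> 'a set set" where
  "R_classes S m = R_class S m ` S"

definition R_le :: "'a set \<Rightarrow> ('a \<Rightarrow> 'a \<Rightarrow> 'a) \<Rightarrow> 'a set \<Rightarrow> 'a set \<Rightarrow> bool" where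
  "R_le S m X Y \<longleftrightarrow> (\<exists>a\<in>X. \<exists>b\<in>Y. right_ideal S m a \<subseteq> right_ideal S m b)"

text \<open>The type argument is the type over which the witnessing regular semigroup ranges
  (HOL cannot quantify existentially over types).\<close>

definition regular_poset :: "'t itself \<Rightarrow> 'p set \<Rightarrow> ('p \<Rightarrow> 'p \<Rightarrow> bool) \<Rightarrow> bool" where
  "regular_poset (_ :: 't itself) P le \<longleftrightarrow>
    (\<exists>(T :: 't set) m \<phi>. regular_semigroup T m \<and> bij_betw \<phi> P (R_classes T m) \<and>
      (\<forall>x\<in>P. \<forall>y\<in>P. le x y \<longleftrightarrow> R_le T m (\<phi> x) (\<phi> y)))"


section \<open>Categories with a distinguished class of inclusions\<close>

text \<open>Composition is written in diagrammatic order: \<open>f ;; g\<close> is first \<open>f\<close>, then \<open>g\<close>; it is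
  meaningful only if \<open>Cod f = Dom g\<close>. The field \<open>Incl\<close> is the set of morphisms of the
  subcategory of inclusions, whose objects are all objects.\<close>

record ('o, 'm) cat =
  Obj :: "'o set"
  Mor :: "'m set"
  Dom :: "'m \<Rightarrow> 'o"
  Cod :: "'m \<Rightarrow> 'o"
  Idn :: "'o \<Rightarrow> 'm"
  Comp :: "'m \<Rightarrow> 'm \<Rightarrow> 'm" (infixl ";;\<index>" 70)
  Incl :: "'m set"

definition hom_set :: "('o, 'm, 'x) cat_scheme \<Rightarrow> 'o \<Rightarrow> 'o \<Rightarrow> 'm set" where
  "hom_set C c d = {f \<in> Mor C. Dom C f = c \<and> Cod C f = d}"

locale category =
  fixes C :: "('o, 'm, 'x) cat_scheme" (structure)
  assumes Dom_in: "f \<in> Mor C \<Longrightarrow> Dom C f \<in> Obj C"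
    and Cod_in: "f \<in> Mor C \<Longrightarrow> Cod C f \<in> Obj C"
    and Idn_in: "c \<in> Obj C \<Longrightarrow> Idn C c \<in> hom_set C c c"
    and Comp_in: "\<lbrakk>f \<in> Mor C; g \<in> Mor C; Cod C f = Dom C g\<rbrakk> \<Longrightarrow> f ;; g \<in> hom_set C (Dom C f) (Cod C g)"
    and Idn_left: "f \<in> Mor C \<Longrightarrow> Idn C (Dom C f) ;; f = f"
    and Idn_right: "f \<in> Mor C \<Longrightarrow> f ;; Idn C (Cod C f) = f"
    and Comp_assoc: "\<lbrakk>f \<in> Mor C; g \<in> Mor C; h \<in> Mor C; Cod C f = Dom C g; Cod C g = Dom C h\<rbrakk>
      \<Longrightarrow> (f ;; g) ;; h = f ;; (g ;; h)"

definition monomorphism :: "('o, 'm, 'x) cat_scheme \<Rightarrow> 'm \<Rightarrow> bool" where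
  "monomorphism C f \<longleftrightarrow> f \<in> Mor C \<and>
    (\<forall>g\<in>Mor C. \<forall>h\<in>Mor C. Cod C g = Dom C f \<and> Cod C h = Dom C f \<and>
      g ;;\<^bsub>C\<^esub> f = h ;;\<^bsub>C\<^esub> f \<longrightarrow> g = h)"

definition isomorphism :: "('o, 'm, 'x) cat_scheme \<Rightarrow> 'm \<Rightarrow> bool" where
  "isomorphism C f \<longleftrightarrow> f \<in> Mor C \<and>
    (\<exists>g\<in>hom_set C (Cod C f) (Dom C f).
      f ;;\<^bsub>C\<^esub> g = Idn C (Dom C f) \<and> g ;;\<^bsub>C\<^esub> f = Idn C (Cod C f))"

definition strict_preorder :: "('o, 'm, 'x) cat_scheme \<Rightarrow> bool" where
  "strict_preorder C \<longleftrightarrow> category C \<and>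
    (\<forall>f\<in>Mor C. \<forall>g\<in>Mor C. Dom C f = Dom C g \<and> Cod C f = Cod C g \<longrightarrow> f = g) \<and>
    (\<forall>f. isomorphism C f \<longrightarrow> f = Idn C (Dom C f))"

definition category_with_subobjects :: "('o, 'm, 'x) cat_scheme \<Rightarrow> bool" where
  "category_with_subobjects C \<longleftrightarrow> category C \<and> Incl C \<subseteq> Mor C \<and>
    strict_preorder (C\<lparr>Mor := Incl C\<rparr>) \<and>
    (\<forall>f\<in>Incl C. monomorphism C f) \<and>
    (\<forall>f\<in>Incl C. \<forall>g\<in>Incl C. \<forall>h\<in>Mor C. Cod C h = Dom C g \<and> f = h ;;\<^bsub>C\<^esub> g \<longrightarrow> h \<in> Incl C)"

definition retraction_of :: "('o, 'm, 'x) cat_scheme \<Rightarrow> 'm \<Rightarrow> 'm \<Rightarrow> bool" where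
  "retraction_of C j q \<longleftrightarrow> j \<in> Incl C \<and> q \<in> hom_set C (Cod C j) (Dom C j) \<and>
    j ;;\<^bsub>C\<^esub> q = Idn C (Dom C j)"

definition splits :: "('o, 'm, 'x) cat_scheme \<Rightarrow> 'm \<Rightarrow> bool" where
  "splits C j \<longleftrightarrow> (\<exists>q. retraction_of C j q)"

definition retraction :: "('o, 'm, 'x) cat_scheme \<Rightarrow> 'm \<Rightarrow> bool" where
  "retraction C q \<longleftrightarrow> (\<exists>j. retraction_of C j q)"

definition normal_factorisation :: "('o, 'm, 'x) cat_scheme \<Rightarrow> 'm \<Rightarrow> 'm \<Rightarrow> 'm \<Rightarrow> 'm \<Rightarrow> bool" where
  "normal_factorisation C f q u j \<longleftrightarrow>
    retraction C q \<and> isomorphism C u \<and> j \<in> Incl C \<and> Cod C q = Dom C u \<and> Cod C u = Dom C j \<and>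
    f = (q ;;\<^bsub>C\<^esub> u) ;;\<^bsub>C\<^esub> j"

text \<open>The epimorphism $f^\circ$; the description is unique in a normal category.\<close>

definition epi_part :: "('o, 'm, 'x) cat_scheme \<Rightarrow> 'm \<Rightarrow> 'm" where
  "epi_part C f = (THE p. \<exists>q u j. normal_factorisation C f q u j \<and> p = q ;;\<^bsub>C\<^esub> u)"

text \<open>In the second clause \<open>j\<close> runs over all inclusions $j(a,b)$ with $a \preceq b$. Cones are
  functions on the set of objects, hence \<open>undefined\<close> elsewhere, so that equality of cones is
  equality in the function type.\<close>

definition is_cone :: "('o, 'm, 'x) cat_scheme \<Rightarrow> 'o \<Rightarrow> ('o \<Rightarrow> 'm) \<Rightarrow> bool" where
  "is_cone C z \<gamma> \<longleftrightarrow> z \<in> Obj C \<and> \<gamma> \<in> (\<Pi>\<^sub>E c\<in>Obj C. hom_set C c z) \<and>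
    (\<forall>j\<in>Incl C. j ;;\<^bsub>C\<^esub> \<gamma> (Cod C j) = \<gamma> (Dom C j)) \<and>
    (\<exists>c\<in>Obj C. isomorphism C (\<gamma> c))"

definition cones :: "('o, 'm, 'x) cat_scheme \<Rightarrow> ('o \<Rightarrow> 'm) set" where
  "cones C = {\<gamma>. \<exists>z. is_cone C z \<gamma>}"

definition vertex :: "('o, 'm, 'x) cat_scheme \<Rightarrow> ('o \<Rightarrow> 'm) \<Rightarrow> 'o" where
  "vertex C \<gamma> = (THE z. is_cone C z \<gamma>)"

definition normal_category :: "('o, 'm, 'x) cat_scheme \<Rightarrow> bool" where
  "normal_category C \<longleftrightarrow> category_with_subobjects C \<and>
    (\<forall>j\<in>Incl C. splits C j) \<and>
    (\<forall>f\<in>Mor C. \<exists>q u j. normal_factorisation C f q u j) \<and>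
    (\<forall>c\<in>Obj C. \<exists>\<mu>. is_cone C c \<mu> \<and> \<mu> c = Idn C c)"


section \<open>The semigroup of cones and connected categories\<close>

definition cone_star :: "('o, 'm, 'x) cat_scheme \<Rightarrow> ('o \<Rightarrow> 'm) \<Rightarrow> 'm \<Rightarrow> ('o \<Rightarrow> 'm)" where
  "cone_star C \<gamma> f = (\<lambda>c\<in>Obj C. \<gamma> c ;;\<^bsub>C\<^esub> f)"

definition cone_mult :: "('o, 'm, 'x) cat_scheme \<Rightarrow> ('o \<Rightarrow> 'm) \<Rightarrow> ('o \<Rightarrow> 'm) \<Rightarrow> ('o \<Rightarrow> 'm)" where
  "cone_mult C \<gamma> \<delta> = cone_star C \<gamma> (epi_part C (\<delta> (vertex C \<gamma>)))"

definition down_set :: "'p set \<Rightarrow> ('p \<Rightarrow> 'p \<Rightarrow> bool) \<Rightarrow> 'p set \<Rightarrow> bool" where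
  "down_set P le D \<longleftrightarrow> D \<subseteq> P \<and> (\<forall>x\<in>P. \<forall>y\<in>D. le x y \<longrightarrow> x \<in> D)"

definition connected_category :: "('o, 'm, 'x) cat_scheme \<Rightarrow> ('o \<Rightarrow> 'm) set set \<Rightarrow> bool" where
  "connected_category C D \<longleftrightarrow> normal_category C \<and>
    down_set (R_classes (cones C) (cone_mult C)) (R_le (cones C) (cone_mult C)) D \<and>
    (\<forall>c\<in>Obj C. \<exists>d\<in>D. \<exists>\<gamma>\<in>d. \<gamma> \<in> idempotents (cones C) (cone_mult C) \<and> vertex C \<gamma> = c)"


section \<open>The category of principal left ideals of a regular semigroup\<close>

definition lmul :: "'a set \<Rightarrow> ('a \<Rightarrow> 'a \<Rightarrow> 'a) \<Rightarrow> 'a \<Rightarrow> 'a set" where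
  "lmul S m e = (\<lambda>x. m x e) ` S"

text \<open>A morphism is a mapping together with its domain and codomain.\<close>

type_synonym 'a lmor = "'a set \<times> ('a \<Rightarrow> 'a) \<times> 'a set"

definition rmap :: "'a set \<Rightarrow> ('a \<Rightarrow> 'a \<Rightarrow> 'a) \<Rightarrow> 'a \<Rightarrow> 'a \<Rightarrow> 'a \<Rightarrow> 'a lmor" where
  "rmap S m e u f = (lmul S m e, (\<lambda>x\<in>lmul S m e. m x u), lmul S m f)"

definition LL :: "'a set \<Rightarrow> ('a \<Rightarrow> 'a \<Rightarrow> 'a) \<Rightarrow> ('a set, 'a lmor) cat" where
  "LL S m = \<lparr>
    Obj = lmul S m ` idempotents S m,
    Mor = {rmap S m e u f | e u f. e \<in> idempotents S m \<and> f \<in> idempotents S m \<and>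
             u \<in> {m (m e s) f | s. s \<in> S}},
    Dom = (\<lambda>(A, g, B). A),
    Cod = (\<lambda>(A, g, B). B),
    Idn = (\<lambda>A. (A, (\<lambda>x\<in>A. x), A)),
    Comp = (\<lambda>(A, g, B) (A', g', B'). (A, compose A g' g, B')),
    Incl = {rmap S m e e f | e f. e \<in> idempotents S m \<and> f \<in> idempotents S m \<and>
              lmul S m e \<subseteq> lmul S m f}\<rparr>"

text \<open>The principal cone $r^a$. Its value at an object depends neither on the idempotent \<open>e\<close>
  generating the object nor on the idempotent \<open>f\<close> in the $\mathscr L$-class of \<open>a\<close>.\<close>

definition principal_cone :: "'a set \<Rightarrow> ('a \<Rightarrow> 'a \<Rightarrow> 'a) \<Rightarrow> 'a \<Rightarrow> ('a set \<Rightarrow> 'a lmor)" where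
  "principal_cone S m a = (\<lambda>X\<in>Obj (LL S m).
    let e = (SOME e. e \<in> idempotents S m \<and> lmul S m e = X);
        f = (SOME f. f \<in> idempotents S m \<and> f \<in> L_class S m a)
    in rmap S m e (m e a) f)"

definition principal_R_classes :: "'a set \<Rightarrow> ('a \<Rightarrow> 'a \<Rightarrow> 'a) \<Rightarrow> ('a set \<Rightarrow> 'a lmor) set set" where
  "principal_R_classes S m =
    (\<lambda>e. R_class (cones (LL S m)) (cone_mult (LL S m)) (principal_cone S m e)) ` idempotents S m"

end

theory Submission
  imports Defs
begin

text \<open>The multiplication of cones satisfies $r^a \cdot \delta = r^{av}$ whenever $\delta(Sa)$ is the
  translation $x \mapsto xv$. Hence the principal right ideal of $\widehat{\mathbb L(S)}$ generated
  by $r^a$ is the image of $aS$ under $a \mapsto r^a$; in particular it consists of principal cones,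
  each of which is $\mathscr R$-related to some $r^g$ with $g$ idempotent, and $\mathfrak R$ is a
  down-set. Left reductivity makes $a \mapsto r^a$ injective, so that $R_{r^e} \mapsto R_e$ is an
  order isomorphism from $\mathfrak R$ onto $S/\mathscr R$.\<close>

section \<open>Regular semigroups\<close>

text \<open>The order on classes is defined through some pair of representatives. All members of a
  class generate the same right ideal, so any other pair decides it equally well.\<close>

lemma R_le_R_class:
  assumes "a \<in> T" "b \<in> T"
  shows "R_le T n (R_class T n a) (R_class T n b) \<longleftrightarrow> right_ideal T n a \<subseteq> right_ideal T n b"
  using assms by (auto simp: R_le_def R_class_def)

lemma R_class_eq_iff:
  assumes "a \<in> T"
  shows "R_class T n a = R_class T n b \<longleftrightarrow> right_ideal T n a = right_ideal T n b"
  using assms by (auto simp: R_class_def)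

locale regular_sg =
  fixes S :: "'a set" and m :: "'a \<Rightarrow> 'a \<Rightarrow> 'a" (infixl "\<cdot>" 70)
  assumes regular: "regular_semigroup S m"
begin

abbreviation "E \<equiv> idempotents S m"
abbreviation "L \<equiv> lmul S m"
abbreviation "LS \<equiv> LL S m"
abbreviation "r \<equiv> principal_cone S m"

lemma closed [simp]: "a \<in> S \<Longrightarrow> b \<in> S \<Longrightarrow> a \<cdot> b \<in> S"
  using regular by (auto simp: regular_semigroup_def semigroup_on_def)

lemma assoc: "a \<in> S \<Longrightarrow> b \<in> S \<Longrightarrow> c \<in> S \<Longrightarrow> a \<cdot> b \<cdot> c = a \<cdot> (b \<cdot> c)"
  using regular by (auto simp: regular_semigroup_def semigroup_on_def)

text \<open>The last conclusion is the equation before it multiplied on the right by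
  \<open>y\<close>, in the right-bracketed shape that products take after rewriting with
  \<open>assoc\<close>.\<close>

lemma quasi_inverse:
  assumes "a \<in> S"
  obtains x where "x \<in> S" "a \<cdot> (x \<cdot> a) = a" "\<And>y. y \<in> S \<Longrightarrow> a \<cdot> (x \<cdot> (a \<cdot> y)) = a \<cdot> y"
proof -
  obtain x where x: "x \<in> S" "a \<cdot> (x \<cdot> a) = a"
    using regular assms by (metis assoc regular_semigroup_def)
  have "a \<cdot> (x \<cdot> (a \<cdot> y)) = a \<cdot> y" if "y \<in> S" for y
    using that x assms by (metis assoc closed)
  with x that show thesis by blast
qed

lemma idem_in [simp]: "e \<in> E \<Longrightarrow> e \<in> S"
  and idem_eq [simp]: "e \<in> E \<Longrightarrow> e \<cdot> e = e"
  by (auto simp: idempotents_def)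

lemma idemI: "e \<in> S \<Longrightarrow> e \<cdot> e = e \<Longrightarrow> e \<in> E"
  unfolding idempotents_def by blast

lemma mem_L: "x \<in> L a \<longleftrightarrow> (\<exists>s\<in>S. x = s \<cdot> a)"
  by (auto simp: lmul_def)

lemma L_in: "a \<in> S \<Longrightarrow> x \<in> L a \<Longrightarrow> x \<in> S"
  by (auto simp: mem_L)

lemma L_self: "a \<in> S \<Longrightarrow> a \<in> L a"
  by (metis assoc closed mem_L quasi_inverse)

lemma L_idem_right [simp]: "e \<in> E \<Longrightarrow> x \<in> L e \<Longrightarrow> x \<cdot> e = x"
  by (auto simp: mem_L assoc)

lemma L_idem_left: "e \<in> E \<Longrightarrow> x \<in> L e \<Longrightarrow> a \<in> S \<Longrightarrow> x \<cdot> (e \<cdot> a) = x \<cdot> a"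
  by (metis L_idem_right L_in assoc idem_in)

lemma mult_in_L: "x \<in> S \<Longrightarrow> x \<cdot> a \<in> L a"
  by (auto simp: mem_L)

lemma L_subset: "a \<in> S \<Longrightarrow> b \<in> L a \<Longrightarrow> L b \<subseteq> L a"
  by (auto simp: mem_L assoc[symmetric]) (metis closed)

lemma left_ideal_eq_L: "a \<in> S \<Longrightarrow> left_ideal S m a = L a"
  using L_self by (auto simp: left_ideal_def lmul_def)

lemma idem_L:
  assumes "a \<in> S"
  obtains f where "f \<in> E" "L f = L a"
proof -
  obtain x where x: "x \<in> S" "a \<cdot> (x \<cdot> a) = a" "\<And>y. y \<in> S \<Longrightarrow> a \<cdot> (x \<cdot> (a \<cdot> y)) = a \<cdot> y"
    using quasi_inverse assms by blast
  \<comment> \<open>From axa = a it follows that xa is an idempotent generating the same left ideal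
    as a.\<close>
  have "x \<cdot> a \<in> E" using x assms by (intro idemI) (simp_all add: assoc)
  moreover have "L (x \<cdot> a) = L a"
    using x assms by (auto simp: mem_L set_eq_iff) (metis assoc closed)+
  ultimately show thesis using that by blast
qed

lemma right_ideal_regular: "a \<in> S \<Longrightarrow> right_ideal S m a = (\<lambda>x. a \<cdot> x) ` S"
  by (auto simp: right_ideal_def image_iff) (metis closed quasi_inverse)

lemma right_ideal_sub: "a \<in> S \<Longrightarrow> right_ideal S m a \<subseteq> S"
  by (auto simp: right_ideal_def)

lemma idem_R:
  assumes "a \<in> S"
  obtains g where "g \<in> E" "right_ideal S m g = right_ideal S m a"
proof -
  obtain x where x: "x \<in> S" "a \<cdot> (x \<cdot> a) = a" "\<And>y. y \<in> S \<Longrightarrow> a \<cdot> (x \<cdot> (a \<cdot> y)) = a \<cdot> y"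
    using quasi_inverse assms by blast
  \<comment> \<open>On the right-hand side the idempotent is ax, which generates the right ideal of
    a.\<close>
  have "a \<cdot> x \<in> E" using x assms by (intro idemI) (simp_all add: assoc)
  moreover have "right_ideal S m (a \<cdot> x) = right_ideal S m a"
    using x assms by (auto simp: right_ideal_regular image_iff set_eq_iff) (metis assoc closed)+
  ultimately show thesis using that by blast
qed


section \<open>The category of principal left ideals\<close>

text \<open>Indexes a morphism by its domain and codomain as sets rather than by idempotent
  generators, so that choices of generators disappear. Elements \<open>u\<close> that agree as right
  multipliers on \<open>A\<close> give the same triple.\<close>

definition translation :: "'a set \<Rightarrow> 'a \<Rightarrow> 'a set \<Rightarrow> 'a lmor" where
  "translation A u B = (A, \<lambda>x\<in>A. x \<cdot> u, B)"

lemma LL_simps [simp]: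
  "Dom LS (A, g, B) = A" "Cod LS (A, g, B) = B"
  "Comp LS (A, g, B) (A', g', B') = (A, compose A g' g, B')"
  "Idn LS A = (A, \<lambda>x\<in>A. x, A)"
  by (simp_all add: LL_def)

lemma Obj_LL: "Obj LS = L ` E"
  by (simp add: LL_def)

lemma Obj_LL_iff: "A \<in> Obj LS \<longleftrightarrow> (\<exists>a\<in>S. A = L a)"
  unfolding Obj_LL by (metis idem_L idem_in imageE imageI)

lemma Obj_in: "A \<in> Obj LS \<Longrightarrow> x \<in> A \<Longrightarrow> x \<in> S"
  by (auto simp: Obj_LL_iff L_in)

lemma translation_dom_cod [simp]:
  "Dom LS (translation A u B) = A" "Cod LS (translation A u B) = B"
  by (simp_all add: translation_def)

lemma translation_cong:
  "(\<And>x. x \<in> A \<Longrightarrow> x \<cdot> u = x \<cdot> v) \<Longrightarrow> translation A u B = translation A v B"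
  by (auto simp: translation_def fun_eq_iff restrict_def)

lemma rmap_in_Mor: "e \<in> E \<Longrightarrow> f \<in> E \<Longrightarrow> s \<in> S \<Longrightarrow> rmap S m e (e \<cdot> s \<cdot> f) f \<in> Mor LS"
  by (simp add: LL_def) blast

lemma rmap_eq: "rmap S m e u f = translation (L e) u (L f)"
  by (simp add: rmap_def translation_def)

text \<open>The normal form u in eSf can be relaxed to any \<open>u\<close> that maps A = Se into B
  = Sf: replacing \<open>u\<close> by eu leaves the map on Se unchanged, and eu = e(eu)f because eu
  lies in Sf.\<close>

lemma Mor_LL_iff:
  "F \<in> Mor LS \<longleftrightarrow> (\<exists>A\<in>Obj LS. \<exists>B\<in>Obj LS. \<exists>u\<in>S. F = translation A u B \<and> (\<forall>x\<in>A. x \<cdot> u \<in> B))"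
proof
  assume "F \<in> Mor LS"
  then obtain e u f s where *: "F = rmap S m e u f" "e \<in> E" "f \<in> E" "s \<in> S" "u = e \<cdot> s \<cdot> f"
    by (auto simp: LL_def)
  then have "F = translation (L e) u (L f)" by (simp add: rmap_eq)
  moreover have "x \<cdot> u \<in> L f" if "x \<in> L e" for x
    unfolding mem_L using * that L_in[of e x] by (intro bexI[of _ "x \<cdot> (e \<cdot> s)"]) (simp_all add: assoc)
  ultimately show "\<exists>A\<in>Obj LS. \<exists>B\<in>Obj LS. \<exists>u\<in>S. F = translation A u B \<and> (\<forall>x\<in>A. x \<cdot> u \<in> B)"
    using * by (intro bexI[of _ "L e"] bexI[of _ "L f"] bexI[of _ u]) (auto simp: Obj_LL)
next
  assume "\<exists>A\<in>Obj LS. \<exists>B\<in>Obj LS. \<exists>u\<in>S. F = translation A u B \<and> (\<forall>x\<in>A. x \<cdot> u \<in> B)"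
  then obtain e f u where *: "e \<in> E" "f \<in> E" "u \<in> S" "F = translation (L e) u (L f)"
      "\<forall>x\<in>L e. x \<cdot> u \<in> L f"
    by (auto simp: Obj_LL)
  have "e \<cdot> u \<in> L f" using * L_self by simp
  then have "e \<cdot> u = e \<cdot> (e \<cdot> u) \<cdot> f" using * by (metis L_idem_right assoc idem_eq idem_in)
  moreover have "F = rmap S m e (e \<cdot> u) f"
    using * by (auto simp: rmap_eq L_idem_left intro: translation_cong)
  moreover have "e \<cdot> u \<in> S" using * by simp
  ultimately show "F \<in> Mor LS" using * by (metis rmap_in_Mor)
qed

lemma Incl_LL_iff:
  "F \<in> Incl LS \<longleftrightarrow> (\<exists>A\<in>Obj LS. \<exists>B\<in>Obj LS. F = (A, \<lambda>x\<in>A. x, B) \<and> A \<subseteq> B)"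
proof -
  have "rmap S m e e f = (L e, \<lambda>x\<in>L e. x, L f)" if "e \<in> E" for e f
    using that by (auto simp: rmap_def fun_eq_iff restrict_def)
  then show ?thesis by (simp add: LL_def) (auto; metis)
qed

lemma Obj_idem:
  assumes "A \<in> Obj LS"
  obtains e where "e \<in> E" "A = L e"
  using assms by (auto simp: Obj_LL)

lemma inclusion_translation:
  "e \<in> E \<Longrightarrow> (L e, \<lambda>x\<in>L e. x, B) = translation (L e) e B"
  by (auto simp: translation_def fun_eq_iff restrict_def)

lemma translation_in:
  "\<lbrakk>A \<in> Obj LS; B \<in> Obj LS; u \<in> S; \<And>x. x \<in> A \<Longrightarrow> x \<cdot> u \<in> B\<rbrakk> \<Longrightarrow> translation A u B \<in> Mor LS"
  by (auto simp: Mor_LL_iff)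

lemma Mor_cases:
  assumes "F \<in> Mor LS"
  obtains A u B where "A \<in> Obj LS" "B \<in> Obj LS" "u \<in> S" "F = translation A u B"
    "\<And>x. x \<in> A \<Longrightarrow> x \<cdot> u \<in> B"
  using assms by (auto simp: Mor_LL_iff)

lemma Incl_Mor: "Incl LS \<subseteq> Mor LS"
proof
  fix F assume "F \<in> Incl LS"
  then obtain A B where *: "A \<in> Obj LS" "B \<in> Obj LS" "F = (A, \<lambda>x\<in>A. x, B)" "A \<subseteq> B"
    by (auto simp: Incl_LL_iff)
  moreover obtain e where "e \<in> E" "A = L e" using * Obj_idem by blast
  ultimately show "F \<in> Mor LS"
    by (auto simp: inclusion_translation intro!: translation_in)
qed

lemma Comp_translation:
  assumes "A \<in> Obj LS" "u \<in> S" "v \<in> S" "\<And>x. x \<in> A \<Longrightarrow> x \<cdot> u \<in> B"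
  shows "Comp LS (translation A u B) (translation B v C) = translation A (u \<cdot> v) C"
  using assms Obj_in[OF assms(1)]
  by (auto simp: translation_def compose_def fun_eq_iff restrict_def assoc)

lemma Comp_translation_inclusion:
  "(\<And>x. x \<in> A \<Longrightarrow> x \<cdot> u \<in> B) \<Longrightarrow>
    Comp LS (translation A u B) (B, \<lambda>x\<in>B. x, C) = translation A u C"
  by (simp add: translation_def compose_def fun_eq_iff restrict_def)

section \<open>Category structure and subobjects\<close>

lemma Mor_fun:
  assumes "(A, g, B) \<in> Mor LS"
  shows "g \<in> A \<rightarrow>\<^sub>E B" "A \<in> Obj LS" "B \<in> Obj LS"
  using assms by (auto simp: Mor_LL_iff translation_def)

lemma Idn_Incl: "A \<in> Obj LS \<Longrightarrow> Idn LS A \<in> Incl LS"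
  by (auto simp: Incl_LL_iff)

lemma Comp_Mor:
  assumes "F \<in> Mor LS" "G \<in> Mor LS" "Cod LS F = Dom LS G"
  shows "Comp LS F G \<in> Mor LS"
  using assms by (elim Mor_cases) (auto simp: Comp_translation Obj_in assoc[symmetric] intro!: translation_in)

lemma Comp_dom_cod [simp]:
  "Dom LS (Comp LS F G) = Dom LS F" "Cod LS (Comp LS F G) = Cod LS G"
  by (cases F; cases G; simp)+

text \<open>Stated for a class \<open>M\<close> of morphisms so that it serves both the whole
  category and its subcategory of inclusions. The identity and associativity laws are those of
  extensional functions.\<close>

lemma category_restrict:
  assumes "M \<subseteq> Mor LS" "\<And>A. A \<in> Obj LS \<Longrightarrow> Idn LS A \<in> M"
    and "\<And>F G. F \<in> M \<Longrightarrow> G \<in> M \<Longrightarrow> Cod LS F = Dom LS G \<Longrightarrow> Comp LS F G \<in> M"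
  shows "category (LS\<lparr>Mor := M\<rparr>)"
proof
  have fn: "g \<in> A \<rightarrow>\<^sub>E B \<and> A \<in> Obj LS \<and> B \<in> Obj LS" if "(A, g, B) \<in> M" for A g B
  proof -
    have "(A, g, B) \<in> Mor LS" using that assms(1) by blast
    from Mor_fun[OF this] show ?thesis by simp
  qed
  fix F assume F: "F \<in> Mor (LS\<lparr>Mor := M\<rparr>)"
  obtain A f B where FE: "F = (A, f, B)" by (cases F)
  with F fn have f: "f \<in> A \<rightarrow>\<^sub>E B" "A \<in> Obj LS" "B \<in> Obj LS" by auto
  show "Dom (LS\<lparr>Mor := M\<rparr>) F \<in> Obj (LS\<lparr>Mor := M\<rparr>)" using f FE by simp
  show "Cod (LS\<lparr>Mor := M\<rparr>) F \<in> Obj (LS\<lparr>Mor := M\<rparr>)" using f FE by simp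
  show "Comp (LS\<lparr>Mor := M\<rparr>) (Idn (LS\<lparr>Mor := M\<rparr>) (Dom (LS\<lparr>Mor := M\<rparr>) F)) F = F"
    using f by (auto simp: FE compose_def fun_eq_iff PiE_def extensional_def)
  show "Comp (LS\<lparr>Mor := M\<rparr>) F (Idn (LS\<lparr>Mor := M\<rparr>) (Cod (LS\<lparr>Mor := M\<rparr>) F)) = F"
    using f by (auto simp: FE compose_def fun_eq_iff PiE_def extensional_def)
  fix G assume G: "G \<in> Mor (LS\<lparr>Mor := M\<rparr>)" and FG: "Cod (LS\<lparr>Mor := M\<rparr>) F = Dom (LS\<lparr>Mor := M\<rparr>) G"
  show "Comp (LS\<lparr>Mor := M\<rparr>) F G \<in> hom_set (LS\<lparr>Mor := M\<rparr>) (Dom (LS\<lparr>Mor := M\<rparr>) F) (Cod (LS\<lparr>Mor := M\<rparr>) G)"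
    using F G FG assms(3) by (simp add: hom_set_def)
  fix H assume H: "H \<in> Mor (LS\<lparr>Mor := M\<rparr>)" and GH: "Cod (LS\<lparr>Mor := M\<rparr>) G = Dom (LS\<lparr>Mor := M\<rparr>) H"
  show "Comp (LS\<lparr>Mor := M\<rparr>) (Comp (LS\<lparr>Mor := M\<rparr>) F G) H =
      Comp (LS\<lparr>Mor := M\<rparr>) F (Comp (LS\<lparr>Mor := M\<rparr>) G H)"
    using f FG by (cases G; cases H) (auto simp: FE compose_def fun_eq_iff restrict_def PiE_def Pi_def)
next
  fix A assume "A \<in> Obj (LS\<lparr>Mor := M\<rparr>)"
  then show "Idn (LS\<lparr>Mor := M\<rparr>) A \<in> hom_set (LS\<lparr>Mor := M\<rparr>) A A"
    using assms(2) by (simp add: hom_set_def)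
qed

lemma category_LL: "category LS"
  using category_restrict[of "Mor LS"] Idn_Incl Incl_Mor Comp_Mor by auto

lemma Comp_inclusion:
  "A \<subseteq> B \<Longrightarrow> compose A (\<lambda>x\<in>B. x) (\<lambda>x\<in>A. x) = (\<lambda>x\<in>A. x)"
  by (auto simp: compose_def fun_eq_iff restrict_def)

lemma strict_preorder_Incl: "strict_preorder (LS\<lparr>Mor := Incl LS\<rparr>)"
proof -
  have "Comp LS F G \<in> Incl LS" if "F \<in> Incl LS" "G \<in> Incl LS" "Cod LS F = Dom LS G" for F G
    using that by (auto simp: Incl_LL_iff Comp_inclusion)
  then have "category (LS\<lparr>Mor := Incl LS\<rparr>)"
    using Incl_Mor Idn_Incl by (intro category_restrict) auto
  moreover have "F = Idn LS (Dom LS F)" if "isomorphism (LS\<lparr>Mor := Incl LS\<rparr>) F" for F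
    using that by (auto simp: isomorphism_def hom_set_def Incl_LL_iff)
  ultimately show ?thesis
    by (auto simp: strict_preorder_def Incl_LL_iff)
qed

lemma Incl_monomorphism:
  assumes "F \<in> Incl LS"
  shows "monomorphism LS F"
proof -
  obtain A B where F: "F = (A, \<lambda>x\<in>A. x, B)" using assms by (auto simp: Incl_LL_iff)
  have "G = H" if GM: "G \<in> Mor LS" and HM: "H \<in> Mor LS"
      and cod: "Cod LS G = A" "Cod LS H = A" and eq: "Comp LS G F = Comp LS H F" for G H
  proof -
    obtain C g where G: "G = (C, g, A)" using cod by (cases G) auto
    obtain D h where H: "H = (D, h, A)" using cod by (cases H) auto
    have "C = D" using eq by (simp add: F G H)
    have g: "g \<in> C \<rightarrow>\<^sub>E A" and h: "h \<in> C \<rightarrow>\<^sub>E A"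
      using Mor_fun(1) GM HM \<open>C = D\<close> G H by blast+
    \<comment> \<open>Following a map with an inclusion only enlarges its codomain, so the values of
      \<open>g\<close> and \<open>h\<close> can be read off the composites.\<close>
    have "compose C (\<lambda>x\<in>A. x) g = compose C (\<lambda>x\<in>A. x) h" using eq \<open>C = D\<close> by (simp add: F G H)
    then have "g x = h x" if "x \<in> C" for x
      using that g h by (metis PiE_mem compose_eq restrict_apply')
    then show "G = H" using g h \<open>C = D\<close> by (auto simp: G H intro: PiE_ext)
  qed
  then show ?thesis
    using assms Incl_Mor by (auto simp: monomorphism_def F)
qed

lemma category_with_subobjects_LL: "category_with_subobjects LS"
proof -
  have "H \<in> Incl LS" if FI: "F \<in> Incl LS" and GI: "G \<in> Incl LS" and HM: "H \<in> Mor LS"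
    and cod: "Cod LS H = Dom LS G" and eq: "F = Comp LS H G" for F G H
  proof -
    obtain B C where G: "G = (B, \<lambda>x\<in>B. x, C)" "B \<in> Obj LS" using GI by (auto simp: Incl_LL_iff)
    obtain A h where H: "H = (A, h, B)" using cod G by (cases H) auto
    note h = Mor_fun[of A h B, folded H, OF HM]
    \<comment> \<open>If \<open>h\<close> followed by an inclusion is an inclusion, then
      \<open>h\<close> fixes every point of \<open>A\<close>. This forces \<open>A\<close> to lie in
      \<open>B\<close> and makes \<open>h\<close> itself an inclusion.\<close>
    have "compose A (\<lambda>x\<in>B. x) h = (\<lambda>x\<in>A. x)" using FI eq by (auto simp: G H Incl_LL_iff)
    then have id: "h x = x" if "x \<in> A" for x
      using that h by (metis PiE_mem compose_eq restrict_apply')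
    then have "h = (\<lambda>x\<in>A. x)" using h by (auto simp: fun_eq_iff PiE_def extensional_def)
    moreover have "A \<subseteq> B" using h id by (metis PiE_mem subsetI)
    ultimately show "H \<in> Incl LS" using h by (auto simp: H Incl_LL_iff)
  qed
  then show ?thesis
    unfolding category_with_subobjects_def
    using category_LL Incl_Mor strict_preorder_Incl Incl_monomorphism by blast
qed

section \<open>Retractions, isomorphisms and normal factorisations\<close>

lemma retraction_of_translation:
  assumes "e \<in> E" "B \<in> Obj LS" "L e \<subseteq> B"
  shows "retraction_of LS (L e, \<lambda>x\<in>L e. x, B) (translation B e (L e))"
proof -
  have "translation B e (L e) \<in> Mor LS"
    using assms Obj_in by (intro translation_in) (auto simp: Obj_LL mult_in_L)
  moreover have "Comp LS (L e, \<lambda>x\<in>L e. x, B) (translation B e (L e)) = Idn LS (L e)"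
    using assms by (auto simp: translation_def compose_def fun_eq_iff restrict_def)
  ultimately show ?thesis
    using assms by (auto simp: retraction_of_def hom_set_def Incl_LL_iff Obj_LL)
qed

lemma Incl_splits: "J \<in> Incl LS \<Longrightarrow> splits LS J"
  unfolding splits_def Incl_LL_iff using retraction_of_translation Obj_idem by metis

text \<open>The inverse is translation by \<open>v\<close>. On Se the round trip is multiplication
  by uv = e; on Su it sends su to su(vu) = s(uv)u = seu = su.\<close>

lemma isomorphism_translation:
  assumes "e \<in> E" "u \<in> S" "v \<in> S" "e \<cdot> u = u" "v \<cdot> e = v" "u \<cdot> v = e"
  shows "isomorphism LS (translation (L e) u (L u))"
proof -
  have eS: "e \<in> S" using assms by simp
  have uvu: "s \<cdot> u \<cdot> (v \<cdot> u) = s \<cdot> u" if "s \<in> S" for s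
    using that assms eS by (metis assoc closed)
  have ob: "L e \<in> Obj LS" "L u \<in> Obj LS" using assms by (auto simp: Obj_LL_iff)
  have 1: "x \<cdot> u \<in> L u" if "x \<in> L e" for x using that eS L_in mem_L by blast
  have 2: "x \<cdot> v \<in> L e" if "x \<in> L u" for x
    using that assms eS by (metis L_in assoc closed mem_L)
  have "translation (L e) u (L u) \<in> Mor LS" "translation (L u) v (L e) \<in> Mor LS"
    using 1 2 ob assms by (auto intro: translation_in)
  moreover have "Comp LS (translation (L e) u (L u)) (translation (L u) v (L e)) = Idn LS (L e)"
    using 1 ob assms by (simp add: Comp_translation inclusion_translation)
  moreover have "Comp LS (translation (L u) v (L e)) (translation (L e) u (L u)) = Idn LS (L u)"
    using 2 ob assms uvu
    by (auto simp: Comp_translation) (auto simp: translation_def fun_eq_iff restrict_def mem_L)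
  ultimately show ?thesis
    unfolding isomorphism_def
    by (intro conjI bexI[of _ "translation (L u) v (L e)"]) (simp_all add: hom_set_def)
qed

text \<open>The idempotent ax fixes a from the left but need not lie in Se. Since ea = a, the
  element axe is still an idempotent fixing a from the left, and it does lie in Se.\<close>

lemma isomorphism_regular:
  assumes "a \<in> S" "e \<in> E" "e \<cdot> a = a"
  obtains g where "g \<in> E" "g \<in> L e" "g \<cdot> a = a" "isomorphism LS (translation (L g) a (L a))"
proof -
  obtain x where x: "x \<in> S" "a \<cdot> (x \<cdot> a) = a" "\<And>y. y \<in> S \<Longrightarrow> a \<cdot> (x \<cdot> (a \<cdot> y)) = a \<cdot> y"
    using quasi_inverse assms by blast
  have ea: "e \<cdot> (a \<cdot> y) = a \<cdot> y" if "y \<in> S" for y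
    using that assms by (metis assoc idem_in)
  have eS: "e \<in> S" using assms by simp
  \<comment> \<open>With these choices v = xg, hence av = axg = g, as
    \<open>isomorphism_translation\<close> requires of the inverse.\<close>
  define g v where "g = a \<cdot> (x \<cdot> e)" and "v = x \<cdot> (a \<cdot> (x \<cdot> e))"
  have gE: "g \<in> E" using x ea assms eS by (intro idemI) (simp_all add: g_def assoc)
  moreover have "g \<in> L e"
    unfolding mem_L by (rule bexI[of _ "a \<cdot> x"]) (use x eS assms in \<open>simp_all add: g_def assoc\<close>)
  moreover have ga: "g \<cdot> a = a" using x ea assms eS by (simp add: g_def assoc)
  moreover have "isomorphism LS (translation (L g) a (L a))"
  proof (rule isomorphism_translation[of _ _ v])
    show "v \<in> S" using x eS assms by (simp add: v_def)
    show "v \<cdot> g = v" using x ea assms eS by (simp add: v_def g_def assoc)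
    show "a \<cdot> v = g" using x eS assms by (simp add: v_def g_def)
  qed (use gE ga assms in auto)
  ultimately show thesis using that by blast
qed

lemma normal_factorisation_exists:
  assumes "F \<in> Mor LS"
  shows "\<exists>q u j. normal_factorisation LS F q u j"
proof -
  obtain A w B where F: "A \<in> Obj LS" "B \<in> Obj LS" "w \<in> S" "F = translation A w B"
      "\<And>x. x \<in> A \<Longrightarrow> x \<cdot> w \<in> B"
    using assms Mor_cases by blast
  obtain e where e: "e \<in> E" "A = L e" using F Obj_idem by blast
  have eS: "e \<in> S" using e by simp
  \<comment> \<open>On Se the elements w and ew act alike, and the latter also satisfies eu = u,
    which \<open>isomorphism_regular\<close> needs.\<close>
  define u where "u = e \<cdot> w"
  have u: "u \<in> S" "e \<cdot> u = u" "u \<in> B"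
    using e F eS L_self by (auto simp: u_def assoc[symmetric])
  have Fu: "F = translation (L e) u B"
    using F e by (auto simp: u_def L_idem_left intro: translation_cong)
  obtain f where f: "f \<in> E" "B = L f" using F Obj_idem by blast
  have LuB: "L u \<subseteq> B" using u f L_subset by auto
  obtain g where g: "g \<in> E" "g \<in> L e" "g \<cdot> u = u" "isomorphism LS (translation (L g) u (L u))"
    using isomorphism_regular[OF u(1) e(1) u(2)] by blast
  have sub: "L g \<subseteq> L e" using g eS by (simp add: L_subset)
  have gS: "g \<in> S" using g by simp
  \<comment> \<open>The idempotent \<open>g\<close> is $\mathscr R$-related to \<open>u\<close>, so \<open>u\<close> factors as $Se \to Sg \cong Su \subseteq B$.\<close>
  define q where "q = translation (L e) g (L g)"
  define j where "j = (L u, \<lambda>x\<in>L u. x, B)"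
  have "retraction LS q"
    unfolding retraction_def q_def using retraction_of_translation[of g "L e"] g sub F e by blast
  moreover have "j \<in> Incl LS"
    using F u LuB by (auto simp: Incl_LL_iff j_def Obj_LL_iff)
  moreover have "Comp LS q (translation (L g) u (L u)) = translation (L e) (g \<cdot> u) (L u)"
    unfolding q_def using F(1) e gS u(1) L_in[OF eS] by (intro Comp_translation mult_in_L) auto
  then have "Comp LS q (translation (L g) u (L u)) = translation (L e) u (L u)" by (simp add: g)
  moreover have "F = Comp LS (translation (L e) u (L u)) j"
    unfolding Fu j_def using L_in[OF eS] by (simp add: Comp_translation_inclusion mult_in_L)
  ultimately show ?thesis
    unfolding normal_factorisation_def using g
    by (intro exI[of _ q] exI[of _ "translation (L g) u (L u)"] exI[of _ j]) (auto simp: q_def j_def)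
qed

section \<open>Images and epimorphic parts\<close>

lemma retraction_surj:
  assumes "retraction LS (A, q, B)"
  shows "q ` A = B"
proof -
  obtain J where J: "retraction_of LS J (A, q, B)" using assms by (auto simp: retraction_def)
  then obtain j where j: "J = (B, j, A)"
    by (cases J) (auto simp: retraction_of_def hom_set_def)
  have "(A, q, B) \<in> Mor LS" "J \<in> Mor LS"
    using J Incl_Mor by (auto simp: retraction_of_def hom_set_def)
  then have "q \<in> A \<rightarrow>\<^sub>E B" "j \<in> B \<rightarrow>\<^sub>E A" using Mor_fun j by auto
  moreover have "q (j x) = x" if "x \<in> B" for x
    using J that by (auto simp: j retraction_of_def compose_def fun_eq_iff restrict_def) metis
  ultimately show ?thesis by (auto simp: image_iff PiE_def Pi_def) metis
qed

lemma isomorphism_surj: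
  assumes "isomorphism LS (A, u, B)"
  shows "u ` A = B"
proof -
  obtain V where V: "(A, u, B) \<in> Mor LS" "V \<in> hom_set LS B A" "Comp LS V (A, u, B) = Idn LS B"
    using assms by (auto simp: isomorphism_def)
  then obtain v where v: "V = (B, v, A)" by (cases V) (auto simp: hom_set_def)
  have "u \<in> A \<rightarrow>\<^sub>E B" "v \<in> B \<rightarrow>\<^sub>E A" using Mor_fun V v by (auto simp: hom_set_def)
  moreover have "u (v x) = x" if "x \<in> B" for x
    using V that by (auto simp: v compose_def fun_eq_iff restrict_def) metis
  ultimately show ?thesis by (auto simp: image_iff PiE_def Pi_def) metis
qed

text \<open>Retractions and isomorphisms are surjective as maps and inclusions do not change values.
  So qu has the values of \<open>f\<close> and its codomain is the image of \<open>f\<close>,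
  whatever factorisation was taken.\<close>

lemma normal_factorisation_epi:
  assumes "normal_factorisation LS (A, f, B) q u j"
  shows "Comp LS q u = (A, f, f ` A)"
proof -
  note nf = assms[unfolded normal_factorisation_def]
  obtain Q q' X where q: "q = (Q, q', X)" by (cases q)
  then obtain u' Y where u: "u = (X, u', Y)" using nf by (cases u) auto
  have qs: "q' ` Q = X" using nf retraction_surj unfolding q by blast
  have us: "u' ` X = Y" using nf isomorphism_surj unfolding u by blast
  have j: "j = (Y, \<lambda>x\<in>Y. x, B)" and AQ: "A = Q"
    using nf by (auto simp: q u Incl_LL_iff)
  have mem: "u' (q' x) \<in> Y" if "x \<in> Q" for x using that qs us by blast
  then have "f = compose Q u' q'"
    using nf by (auto simp: q u j compose_def fun_eq_iff restrict_def)
  moreover have "compose Q u' q' ` Q = Y"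
    using qs us by (auto simp: compose_def image_iff)
  ultimately show ?thesis using AQ by (simp add: q u)
qed

text \<open>Existence of a normal factorisation together with the independence just shown justifies
  the definite description.\<close>

lemma epi_part_LL:
  assumes "(A, f, B) \<in> Mor LS"
  shows "epi_part LS (A, f, B) = (A, f, f ` A)"
  unfolding epi_part_def
  using normal_factorisation_exists[OF assms] normal_factorisation_epi
  by (intro the_equality) metis+


section \<open>Principal cones\<close>

text \<open>Removes both choices from the definition: xea = xa for x in X = Se, and \<open>f\<close>
  enters only through Sf = Sa.\<close>

lemma principal_cone_eq:
  assumes "a \<in> S" "X \<in> Obj LS"
  shows "r a X = translation X a (L a)"
proof -
  define e where "e = (SOME e. e \<in> E \<and> L e = X)"
  have e: "e \<in> E \<and> L e = X"
    unfolding e_def by (rule someI_ex) (use assms Obj_idem in blast)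
  define f where "f = (SOME f. f \<in> E \<and> f \<in> L_class S m a)"
  have L_class: "h \<in> L_class S m a \<longleftrightarrow> L h = L a" if "h \<in> E" for h
    using that idem_in[OF that] assms(1) by (simp only: L_class_def mem_Collect_eq left_ideal_eq_L simp_thms)
  obtain h where "h \<in> E" "L h = L a" using idem_L assms(1) by blast
  then have "\<exists>f. f \<in> E \<and> f \<in> L_class S m a" using L_class by blast
  then have "f \<in> E \<and> f \<in> L_class S m a" unfolding f_def by (rule someI_ex)
  then have f: "L f = L a" using L_class by blast
  have "r a X = rmap S m e (e \<cdot> a) f"
    using assms by (simp add: principal_cone_def Let_def e_def f_def)
  also have "\<dots> = translation X a (L a)"
    using e f assms by (auto simp: rmap_eq L_idem_left intro: translation_cong)
  finally show ?thesis .
qed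

lemma principal_cone_is_cone:
  assumes "a \<in> S"
  shows "is_cone LS (L a) (r a)"
proof -
  have La: "L a \<in> Obj LS" using assms by (auto simp: Obj_LL_iff)
  have "translation X a (L a) \<in> hom_set LS X (L a)" if "X \<in> Obj LS" for X
    using that assms La Obj_in by (auto simp: hom_set_def intro!: translation_in mult_in_L)
  then have "r a \<in> (\<Pi>\<^sub>E X\<in>Obj LS. hom_set LS X (L a))"
    using assms by (auto simp: principal_cone_eq) (simp add: principal_cone_def)
  moreover have "Comp LS J (r a (Cod LS J)) = r a (Dom LS J)" if J: "J \<in> Incl LS" for J
    using J assms by (auto simp: Incl_LL_iff principal_cone_eq)
      (auto simp: translation_def compose_def fun_eq_iff restrict_def)
  moreover have "\<exists>X\<in>Obj LS. isomorphism LS (r a X)"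
  proof -
    obtain x where x: "x \<in> S" "a \<cdot> (x \<cdot> a) = a" "\<And>y. y \<in> S \<Longrightarrow> a \<cdot> (x \<cdot> (a \<cdot> y)) = a \<cdot> y"
      using quasi_inverse assms by blast
    \<comment> \<open>The idempotent ax plays the role of e in \<open>isomorphism_regular\<close>;
      the component of the cone at the resulting Sg is an isomorphism.\<close>
    have "a \<cdot> x \<in> E" "a \<cdot> x \<cdot> a = a" using x assms by (auto simp: assoc intro!: idemI)
    then obtain g where "g \<in> E" "isomorphism LS (translation (L g) a (L a))"
      using isomorphism_regular assms by blast
    then show ?thesis using assms by (metis Obj_LL image_eqI principal_cone_eq)
  qed
  ultimately show ?thesis using La by (simp add: is_cone_def)
qed

lemma principal_cone_in: "a \<in> S \<Longrightarrow> r a \<in> cones LS"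
  using principal_cone_is_cone by (auto simp: cones_def)

text \<open>The vertex is the common codomain of the components, and at least one component exists
  because the vertex is itself an object.\<close>

lemma vertex_eq: "is_cone LS z \<gamma> \<Longrightarrow> vertex LS \<gamma> = z"
  unfolding vertex_def
  by (rule the_equality) (assumption, auto simp: is_cone_def hom_set_def PiE_def Pi_def)

lemma normal_category_LL: "normal_category LS"
proof -
  have "\<exists>\<mu>. is_cone LS A \<mu> \<and> \<mu> A = Idn LS A" if A: "A \<in> Obj LS" for A
  proof -
    obtain e where e: "e \<in> E" "A = L e" using A Obj_idem by blast
    \<comment> \<open>Right multiplication by e fixes Se pointwise, so the required cone is the
      principal cone of an idempotent generator.\<close>
    then have "r e A = Idn LS A"
      using A inclusion_translation[of e A] by (simp add: principal_cone_eq)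
    then show ?thesis using principal_cone_is_cone[of e] e by (intro exI[of _ "r e"]) simp
  qed
  then show ?thesis
    unfolding normal_category_def
    using category_with_subobjects_LL Incl_splits normal_factorisation_exists by blast
qed

section \<open>Products of principal cones and the right ideals they generate\<close>

lemma cone_mult_principal:
  assumes "a \<in> S" "v \<in> S" "\<delta> (L a) = translation (L a) v B" "\<delta> (L a) \<in> Mor LS"
  shows "cone_mult LS (r a) \<delta> = r (a \<cdot> v)"
proof
  fix X
  \<comment> \<open>The image of Sa under translation by v is Sav, so the epimorphic part has
    exactly the vertex of the cone of av as codomain.\<close>
  have "(\<lambda>x\<in>L a. x \<cdot> v) ` L a = L (a \<cdot> v)"
    using assms by (auto simp: lmul_def image_image assoc)
  then have ep: "epi_part LS (\<delta> (L a)) = translation (L a) v (L (a \<cdot> v))"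
    using assms epi_part_LL by (simp add: translation_def)
  have "Comp LS (r a X) (translation (L a) v (L (a \<cdot> v))) = r (a \<cdot> v) X" if "X \<in> Obj LS"
    using that assms Obj_in[OF that] by (simp add: principal_cone_eq) (rule Comp_translation; auto simp: mem_L)
  \<comment> \<open>Cones are functions restricted to the objects, so equality must also be checked
    at the default value.\<close>
  moreover have "r (a \<cdot> v) X = undefined" if "X \<notin> Obj LS"
    using that by (simp add: principal_cone_def)
  ultimately show "cone_mult LS (r a) \<delta> X = r (a \<cdot> v) X"
    by (simp add: cone_mult_def cone_star_def vertex_eq[OF principal_cone_is_cone[OF assms(1)]] ep)
qed

lemma cone_mult_principal_principal:
  assumes "a \<in> S" "b \<in> S"
  shows "cone_mult LS (r a) (r b) = r (a \<cdot> b)"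
proof -
  have La: "L a \<in> Obj LS" using assms Obj_LL_iff by blast
  then have "r b (L a) \<in> Mor LS"
    using principal_cone_is_cone[OF assms(2)] by (auto simp: is_cone_def hom_set_def PiE_def Pi_def)
  then show ?thesis using cone_mult_principal principal_cone_eq[OF assms(2) La] assms by blast
qed

text \<open>The right factor ranges over all cones, principal or not. Only its component at Sa
  enters the product, and that component is a translation by some v, which the principal cone of v
  induces as well.\<close>

lemma right_ideal_principal_cone:
  assumes "a \<in> S"
  shows "right_ideal (cones LS) (cone_mult LS) (r a) = r ` right_ideal S m a"
proof -
  have "cone_mult LS (r a) \<delta> \<in> r ` right_ideal S m a" if "\<delta> \<in> cones LS" for \<delta>
  proof -
    have "L a \<in> Obj LS" using assms Obj_LL_iff by blast
    then have "\<delta> (L a) \<in> Mor LS" "Dom LS (\<delta> (L a)) = L a"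
      using that by (auto simp: cones_def is_cone_def hom_set_def PiE_def Pi_def)
    then obtain v B where "v \<in> S" "\<delta> (L a) = translation (L a) v B"
      by (metis Mor_cases translation_dom_cod(1))
    then show ?thesis
      using cone_mult_principal assms \<open>\<delta> (L a) \<in> Mor LS\<close> by (auto simp: right_ideal_def)
  qed
  moreover have "r (a \<cdot> x) \<in> cone_mult LS (r a) ` cones LS" if "x \<in> S" for x
    using that assms principal_cone_in by (metis cone_mult_principal_principal imageI)
  ultimately show ?thesis by (auto simp: right_ideal_def)
qed

lemma principal_cone_inj:
  assumes "left_reductive S m"
  shows "inj_on r S"
proof
  fix a b assume ab: "a \<in> S" "b \<in> S" "r a = r b"
  \<comment> \<open>The component at Sx, evaluated at x itself, recovers xa from the cone.\<close>
  have "x \<cdot> a = x \<cdot> b" if "x \<in> S" for x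
  proof -
    have "L x \<in> Obj LS" using that Obj_LL_iff by blast
    then have "translation (L x) a (L a) = translation (L x) b (L b)"
      using ab principal_cone_eq by metis
    then show ?thesis using L_self[OF that] by (auto simp: translation_def fun_eq_iff restrict_def) metis
  qed
  then have "(\<lambda>x\<in>S. x \<cdot> a) = (\<lambda>x\<in>S. x \<cdot> b)" by (rule restrict_ext)
  then show "a = b" using assms ab unfolding left_reductive_def inj_on_def by blast
qed

section \<open>R-classes of principal cones\<close>

abbreviation "hatR a \<equiv> R_class (cones LS) (cone_mult LS) (r a)"

text \<open>Idempotents suffice because R-related elements of \<open>S\<close> have R-related
  principal cones and every element is R-related to an idempotent.\<close>

lemma principal_R_classes_eq: "principal_R_classes S m = hatR ` S"
proof -
  have "hatR a \<in> hatR ` E" if a: "a \<in> S" for a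
  proof -
    obtain g where g: "g \<in> E" "right_ideal S m g = right_ideal S m a" using idem_R a by blast
    then have "hatR a = hatR g" using a by (simp add: R_class_def right_ideal_principal_cone)
    then show ?thesis using g by blast
  qed
  then show ?thesis by (auto simp: principal_R_classes_def)
qed

lemma connected_category_LL: "connected_category LS (principal_R_classes S m)"
proof -
  let ?C = "cones LS" and ?n = "cone_mult LS"
  have "hatR a \<in> R_classes ?C ?n" if "a \<in> S" for a
    using that principal_cone_in by (auto simp: R_classes_def)
  moreover have "R_class ?C ?n \<gamma> \<in> hatR ` S"
    if "\<gamma> \<in> ?C" "a \<in> S" "R_le ?C ?n (R_class ?C ?n \<gamma>) (hatR a)" for \<gamma> a
  proof -
    have "right_ideal ?C ?n \<gamma> \<subseteq> r ` right_ideal S m a"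
      using that by (simp add: R_le_R_class principal_cone_in right_ideal_principal_cone)
    \<comment> \<open>Hence a cone below a principal cone is itself principal, which gives the
      down-set property.\<close>
    moreover have "\<gamma> \<in> right_ideal ?C ?n \<gamma>" by (simp add: right_ideal_def)
    ultimately show ?thesis using right_ideal_sub that by blast
  qed
  ultimately have "down_set (R_classes ?C ?n) (R_le ?C ?n) (principal_R_classes S m)"
    by (auto simp: down_set_def principal_R_classes_eq R_classes_def)
  moreover have "\<exists>d\<in>principal_R_classes S m. \<exists>\<gamma>\<in>d. \<gamma> \<in> idempotents ?C ?n \<and> vertex LS \<gamma> = A"
    if A: "A \<in> Obj LS" for A
  proof -
    obtain e where e: "e \<in> E" "A = L e" using A Obj_idem by blast
    then have "r e \<in> hatR e" "r e \<in> idempotents ?C ?n" "vertex LS (r e) = A"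
      using principal_cone_in cone_mult_principal_principal vertex_eq[OF principal_cone_is_cone]
      by (simp_all add: R_class_def idempotents_def[of ?C])
    then show ?thesis using e by (auto simp: principal_R_classes_eq)
  qed
  ultimately show ?thesis using normal_category_LL by (simp add: connected_category_def)
qed

lemma regular_poset_principal_R_classes:
  assumes "left_reductive S m"
  shows "regular_poset TYPE('a) (principal_R_classes S m) (R_le (cones LS) (cone_mult LS))"
proof -
  have sub: "right_ideal (cones LS) (cone_mult LS) (r a) \<subseteq> right_ideal (cones LS) (cone_mult LS) (r b)
      \<longleftrightarrow> right_ideal S m a \<subseteq> right_ideal S m b" if "a \<in> S" "b \<in> S" for a b
    using that right_ideal_sub[OF that(1)] right_ideal_sub[OF that(2)]
      inj_on_image_mem_iff[OF principal_cone_inj[OF assms]]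
    by (simp add: right_ideal_principal_cone image_subset_iff) blast
  \<comment> \<open>One direction makes the map \<open>\<phi>\<close> below independent of the
    chosen representative; the other makes it injective.\<close>
  have eq: "hatR a = hatR b \<longleftrightarrow> R_class S m a = R_class S m b" if "a \<in> S" "b \<in> S" for a b
    using that sub[of a b] sub[of b a]
    by (simp only: R_class_eq_iff principal_cone_in) blast
  define \<phi> where "\<phi> X = R_class S m (SOME a. a \<in> S \<and> hatR a = X)" for X
  have \<phi>: "\<phi> (hatR a) = R_class S m a" if "a \<in> S" for a
  proof -
    have "(SOME b. b \<in> S \<and> hatR b = hatR a) \<in> S \<and> hatR (SOME b. b \<in> S \<and> hatR b = hatR a) = hatR a"
      by (rule someI_ex) (use that in blast)
    then show ?thesis unfolding \<phi>_def using eq that by blast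
  qed
  have "bij_betw \<phi> (hatR ` S) (R_classes S m)"
    using eq by (auto simp: bij_betw_def inj_on_def \<phi> R_classes_def image_image)
  moreover have "\<forall>x\<in>hatR ` S. \<forall>y\<in>hatR ` S.
      R_le (cones LS) (cone_mult LS) x y \<longleftrightarrow> R_le S m (\<phi> x) (\<phi> y)"
    using sub by (auto simp: \<phi> R_le_R_class principal_cone_in)
  \<comment> \<open>The witnessing regular semigroup is \<open>S\<close> itself.\<close>
  ultimately show ?thesis
    using regular unfolding regular_poset_def principal_R_classes_eq by blast
qed

end

theorem proposition3p23:
  fixes S :: "'a set" and m :: "'a \<Rightarrow> 'a \<Rightarrow> 'a"
  assumes "regular_semigroup S m" and "left_reductive S m"
  shows "connected_category (LL S m) (principal_R_classes S m) \<and>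
    regular_poset TYPE('a) (principal_R_classes S m)
      (R_le (cones (LL S m)) (cone_mult (LL S m)))"
proof -
  interpret regular_sg S m using assms(1) by unfold_locales
  show ?thesis
    using connected_category_LL regular_poset_principal_R_classes[OF assms(2)] by blast
qed

end
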